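(* Let $K$ be a field, let $J\subseteq I$ be monomial ideals in $R=K[x_1,\ldots,x_n]$, and fix an ordered $n$-tuple $(i_1,\ldots,i_n)$ of positive integers. Then $J$ is a demotion of $I$ if and only if $J^*$ is a demotion of $I^*$, where $I^*$ and $J^*$ denote the expansions of $I$ and $J$ with respect to $(i_1,\ldots,i_n)$.
   Context: For ideals $J\subseteq I$ in a commutative Noetherian ring $R$, $J$ is a demotion of $I$ if $I^rJ^s=I^{r+s}\cap J^s$ for all integers $r,s\geq 0$ (with $I^0=J^0=R$). Expansion: let $R^*=R^{(i_1,\ldots,i_n)}$ be the polynomial ring over $K$ in the variables $x_{11},\ldots,x_{1i_1},x_{21},\ldots,x_{2i_2},\ldots,x_{n1},\ldots,x_{ni_n}$, and let $\mathfrak{p}_j=(x_{j1},\ldots,x_{ji_j})\subseteq R^*$ for $j=1,\ldots,n$. If $I\subset R$ is a monomial ideal with minimal set of monomial generators $\{\mathbf{x}^{\mathbf{a}_1},\ldots,\mathbf{x}^{\mathbf{a}_m}\}$, where $\mathbf{x}^{\mathbf{a}_i}=x_1^{a_i(1)}\cdots x_n^{a_i(n)}$, then the expansion of $I$ with respect to $(i_1,\ldots,i_n)$ is the monomial ideal $I^*=\sum_{i=1}^m \mathfrak{p}_1^{a_i(1)}\cdots\mathfrak{p}_n^{a_i(n)}\subseteq R^*$. *)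

theory Defs
  imports "HOL-Algebra.Ideal_Product" "HOL-Library.Poly_Mapping"
begin

text \<open>
  An exponent vector is a finitely supported map \<open>'v \<Rightarrow>\<^sub>0 nat\<close>, and a polynomial with coefficients
  in \<open>'k\<close> is a finitely supported map from exponent vectors to \<open>'k\<close>. The polynomial ring in a set
  \<open>V\<close> of variables consists of those polynomials in which only variables from \<open>V\<close> occur.
\<close>

definition exps :: "'v set \<Rightarrow> ('v \<Rightarrow>\<^sub>0 nat) set" where
  "exps V = {a. Poly_Mapping.keys a \<subseteq> V}"

definition mpoly_ring :: "'v set \<Rightarrow> (('v \<Rightarrow>\<^sub>0 nat) \<Rightarrow>\<^sub>0 'k::field) ring" where
  "mpoly_ring V = \<lparr>carrier = {p. Poly_Mapping.keys p \<subseteq> exps V}, mult = (*), one = 1,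
                   zero = 0, add = (+)\<rparr>"

definition monomial :: "('v \<Rightarrow>\<^sub>0 nat) \<Rightarrow> (('v \<Rightarrow>\<^sub>0 nat) \<Rightarrow>\<^sub>0 'k::field)" where
  "monomial a = Poly_Mapping.single a 1"

definition variable :: "'v \<Rightarrow> (('v \<Rightarrow>\<^sub>0 nat) \<Rightarrow>\<^sub>0 'k::field)" where
  "variable v = monomial (Poly_Mapping.single v 1)"

definition monomial_ideal :: "'v set \<Rightarrow> (('v \<Rightarrow>\<^sub>0 nat) \<Rightarrow>\<^sub>0 'k::field) set \<Rightarrow> bool" where
  "monomial_ideal V I \<longleftrightarrow> (\<exists>A \<subseteq> exps V. I = genideal (mpoly_ring V) (monomial ` A))"

definition is_min_gens ::
    "'v set \<Rightarrow> (('v \<Rightarrow>\<^sub>0 nat) \<Rightarrow>\<^sub>0 'k::field) set \<Rightarrow> ('v \<Rightarrow>\<^sub>0 nat) set \<Rightarrow> bool" where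
  "is_min_gens V I G \<longleftrightarrow> G \<subseteq> exps V \<and> genideal (mpoly_ring V) (monomial ` G) = I \<and>
     (\<forall>G' \<subset> G. genideal (mpoly_ring V) (monomial ` G') \<noteq> I)"

text \<open>
  The exponent vectors of the minimal monomial generators; \<open>ex1_min_gens\<close> below shows that the
  description is proper for every monomial ideal.
\<close>

definition min_gens :: "'v set \<Rightarrow> (('v \<Rightarrow>\<^sub>0 nat) \<Rightarrow>\<^sub>0 'k::field) set \<Rightarrow> ('v \<Rightarrow>\<^sub>0 nat) set" where
  "min_gens V I = (THE G. is_min_gens V I G)"

text \<open>
  Powers and products of ideals are taken in the monoid of ideals \<^term>\<open>ideals_set R\<close>, whose unit
  is the whole ring; in particular the zeroth power of every ideal is the ring itself.
\<close>

definition demotion :: "('a, 'b) ring_scheme \<Rightarrow> 'a set \<Rightarrow> 'a set \<Rightarrow> bool" where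
  "demotion R J I \<longleftrightarrow> ideal J R \<and> ideal I R \<and> J \<subseteq> I \<and>
     (\<forall>r s :: nat. ideal_prod R (I [^]\<^bsub>ideals_set R\<^esub> r) (J [^]\<^bsub>ideals_set R\<^esub> s)
                     = I [^]\<^bsub>ideals_set R\<^esub> (r + s) \<inter> J [^]\<^bsub>ideals_set R\<^esub> s)"

text \<open>The variable \<open>x\<^bsub>jl\<^esub>\<close> of the expanded ring is indexed by the pair \<open>(j, l)\<close>.\<close>

definition expansion_vars :: "nat \<Rightarrow> (nat \<Rightarrow> nat) \<Rightarrow> (nat \<times> nat) set" where
  "expansion_vars n i = (SIGMA j:{1..n}. {1..i j})"

definition expansion_ring ::
    "nat \<Rightarrow> (nat \<Rightarrow> nat) \<Rightarrow> ((nat \<times> nat \<Rightarrow>\<^sub>0 nat) \<Rightarrow>\<^sub>0 'k::field) ring" where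
  "expansion_ring n i = mpoly_ring (expansion_vars n i)"

definition expansion_prime ::
    "nat \<Rightarrow> (nat \<Rightarrow> nat) \<Rightarrow> nat \<Rightarrow> ((nat \<times> nat \<Rightarrow>\<^sub>0 nat) \<Rightarrow>\<^sub>0 'k::field) set" where
  "expansion_prime n i j = genideal (expansion_ring n i) ((\<lambda>l. variable (j, l)) ` {1..i j})"

text \<open>The sum of a family of ideals is the ideal generated by its union.\<close>

definition expansion ::
    "nat \<Rightarrow> (nat \<Rightarrow> nat) \<Rightarrow> ((nat \<Rightarrow>\<^sub>0 nat) \<Rightarrow>\<^sub>0 'k::field) set
      \<Rightarrow> ((nat \<times> nat \<Rightarrow>\<^sub>0 nat) \<Rightarrow>\<^sub>0 'k) set" where
  "expansion n i I = genideal (expansion_ring n i)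
     (\<Union>a \<in> min_gens {1..n} I.
        \<Otimes>\<^bsub>ideals_set (expansion_ring n i)\<^esub> j \<in> {1..n}.
          expansion_prime n i j [^]\<^bsub>ideals_set (expansion_ring n i)\<^esub> Poly_Mapping.lookup a j)"


subsection \<open>The polynomial ring is a commutative ring\<close>

lemma keys_add_nat: "Poly_Mapping.keys (a + b) = Poly_Mapping.keys a \<union> Poly_Mapping.keys b"
  for a b :: "'v \<Rightarrow>\<^sub>0 nat"
  by (auto simp: in_keys_iff lookup_add)

lemma exps_add_iff: "a + b \<in> exps V \<longleftrightarrow> a \<in> exps V \<and> b \<in> exps V"
  by (auto simp: exps_def keys_add_nat)

lemma keys_mult_exps:
  assumes "Poly_Mapping.keys p \<subseteq> exps V" "Poly_Mapping.keys q \<subseteq> exps V"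
  shows "Poly_Mapping.keys (p * q) \<subseteq> exps V"
  using keys_mult[of p q] assms by (fastforce simp: exps_add_iff)

lemma cring_mpoly_ring: "cring (mpoly_ring V)"
proof (rule cringI)
  show "abelian_group (mpoly_ring V)"
  proof (rule abelian_groupI)
    fix p assume "p \<in> carrier (mpoly_ring V)"
    then show "\<exists>q \<in> carrier (mpoly_ring V). q \<oplus>\<^bsub>mpoly_ring V\<^esub> p = \<zero>\<^bsub>mpoly_ring V\<^esub>"
      by (intro bexI[of _ "- p"]) (auto simp: mpoly_ring_def)
  qed (use keys_add in \<open>fastforce simp: mpoly_ring_def algebra_simps\<close>)+
  show "Group.comm_monoid (mpoly_ring V)"
    by (rule comm_monoidI)
      (auto simp: mpoly_ring_def algebra_simps exps_def dest: keys_mult_exps[unfolded exps_def, THEN subsetD, rotated 2])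
qed (auto simp: mpoly_ring_def algebra_simps)

lemma monomial_closed: "a \<in> exps V \<Longrightarrow> monomial a \<in> carrier (mpoly_ring V)"
  by (auto simp: monomial_def mpoly_ring_def)


subsection \<open>Minimal monomial generating sets exist and are unique\<close>

lemma monomial_in_genideal_iff:
  fixes V :: "'v set"
  assumes G: "G \<subseteq> exps V" and a: "a \<in> exps V"
  shows "(monomial a :: ('v \<Rightarrow>\<^sub>0 nat) \<Rightarrow>\<^sub>0 'k::field) \<in> genideal (mpoly_ring V) (monomial ` G)
           \<longleftrightarrow> (\<exists>g \<in> G. \<exists>h. a = g + h)"
proof
  let ?R = "mpoly_ring V :: (('v \<Rightarrow>\<^sub>0 nat) \<Rightarrow>\<^sub>0 'k) ring"
  interpret R: cring ?R by (rule cring_mpoly_ring)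
  have gens: "monomial ` G \<subseteq> carrier ?R"
    using G by (auto intro: monomial_closed)
  {
    let ?S = "{p \<in> carrier ?R. \<forall>m \<in> Poly_Mapping.keys p. \<exists>g \<in> G. \<exists>h. m = g + h}"
    have mult: "p * q \<in> ?S" if p: "p \<in> ?S" and q: "q \<in> carrier ?R" for p q
    proof -
      have "\<exists>g \<in> G. \<exists>h. m = g + h" if m: "m \<in> Poly_Mapping.keys (p * q)" for m
      proof -
        obtain b c where "m = b + c" "b \<in> Poly_Mapping.keys p"
          using keys_mult[of p q] m by blast
        then show ?thesis using p by (force simp: add.assoc)
      qed
      then show ?thesis
        using p q R.m_closed[of p q] by (auto simp: mpoly_ring_def)
    qed
    have "ideal ?S ?R"
    proof (rule idealI)
      show "ring ?R" by (rule R.ring_axioms)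
      show "subgroup ?S (add_monoid ?R)"
      proof (rule group.subgroupI)
        show "group (add_monoid ?R)" by (rule R.a_group)
        show "?S \<noteq> {}" using R.zero_closed by (auto simp: mpoly_ring_def intro!: exI[of _ 0])
      next
        fix p assume p: "p \<in> ?S"
        have "\<ominus>\<^bsub>?R\<^esub> p = - p"
          by (rule R.minus_equality) (use p in \<open>auto simp: mpoly_ring_def\<close>)
        then have "inv\<^bsub>add_monoid ?R\<^esub> p = - p"
          by (simp add: a_inv_def)
        then show "inv\<^bsub>add_monoid ?R\<^esub> p \<in> ?S"
          using p by (auto simp: mpoly_ring_def)
      next
        fix p q assume pq: "p \<in> ?S" "q \<in> ?S"
        have "Poly_Mapping.keys (p + q) \<subseteq> Poly_Mapping.keys p \<union> Poly_Mapping.keys q"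
          by (rule keys_add)
        then show "p \<otimes>\<^bsub>add_monoid ?R\<^esub> q \<in> ?S"
          using pq by (auto simp: mpoly_ring_def)
      qed (auto simp: mpoly_ring_def)
      show "x \<otimes>\<^bsub>?R\<^esub> p \<in> ?S" if "p \<in> ?S" "x \<in> carrier ?R" for p x
        using mult[OF that] by (simp add: mpoly_ring_def mult.commute)
      show "p \<otimes>\<^bsub>?R\<^esub> x \<in> ?S" if "p \<in> ?S" "x \<in> carrier ?R" for p x
        using mult[OF that] by (simp add: mpoly_ring_def)
    qed
    moreover have "monomial ` G \<subseteq> ?S"
      using gens by (auto simp: monomial_def) (metis add.right_neutral)
    ultimately have sub: "genideal ?R (monomial ` G) \<subseteq> ?S"
      by (rule R.genideal_minimal)
    assume "(monomial a :: ('v \<Rightarrow>\<^sub>0 nat) \<Rightarrow>\<^sub>0 'k) \<in> genideal ?R (monomial ` G)"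
    with sub have "(monomial a :: ('v \<Rightarrow>\<^sub>0 nat) \<Rightarrow>\<^sub>0 'k) \<in> ?S" by blast
    then show "\<exists>g \<in> G. \<exists>h. a = g + h" by (simp add: monomial_def)
  }
  {
    assume "\<exists>g \<in> G. \<exists>h. a = g + h"
    then obtain g h where gh: "g \<in> G" "a = g + h" by blast
    interpret I: ideal "genideal ?R (monomial ` G)" ?R
      by (rule R.genideal_ideal[OF gens])
    have "monomial g \<in> genideal ?R (monomial ` G)"
      using gh(1) R.genideal_self[OF gens] by blast
    moreover have "monomial h \<in> carrier ?R"
      using a gh(2) by (intro monomial_closed) (simp add: exps_add_iff)
    ultimately have "monomial g \<otimes>\<^bsub>?R\<^esub> monomial h \<in> genideal ?R (monomial ` G)"
      by (rule I.I_r_closed)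
    then show "(monomial a :: ('v \<Rightarrow>\<^sub>0 nat) \<Rightarrow>\<^sub>0 'k) \<in> genideal ?R (monomial ` G)"
      by (simp add: gh(2) monomial_def mpoly_ring_def mult_single)
  }
qed

lemma genideal_monomial_subset_iff:
  fixes V :: "'v set"
  assumes "G \<subseteq> exps V" "H \<subseteq> exps V"
  shows "genideal (mpoly_ring V :: (('v \<Rightarrow>\<^sub>0 nat) \<Rightarrow>\<^sub>0 'k::field) ring) (monomial ` G)
           \<subseteq> genideal (mpoly_ring V) (monomial ` H)
           \<longleftrightarrow> (\<forall>g \<in> G. \<exists>h \<in> H. \<exists>d. g = h + d)"
proof -
  let ?R = "mpoly_ring V :: (('v \<Rightarrow>\<^sub>0 nat) \<Rightarrow>\<^sub>0 'k) ring"
  interpret R: cring ?R by (rule cring_mpoly_ring)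
  have "monomial ` G \<subseteq> carrier ?R" "monomial ` H \<subseteq> carrier ?R"
    using assms by (auto intro: monomial_closed)
  then have "genideal ?R (monomial ` G) \<subseteq> genideal ?R (monomial ` H)
               \<longleftrightarrow> monomial ` G \<subseteq> genideal ?R (monomial ` H)"
    by (meson R.Idl_subset_ideal R.genideal_ideal)
  also have "\<dots> \<longleftrightarrow> (\<forall>g \<in> G. \<exists>h \<in> H. \<exists>d. g = h + d)"
    using assms monomial_in_genideal_iff[OF assms(2), where 'k = 'k] by blast
  finally show ?thesis .
qed

lemma exp_dvd_antisym:
  fixes a b :: "'v \<Rightarrow>\<^sub>0 nat"
  assumes "a = b + d" "b = a + e"
  shows "a = b"
proof -
  have "Poly_Mapping.lookup a v = Poly_Mapping.lookup b v" for v
    using arg_cong[OF assms(1), of "\<lambda>f. Poly_Mapping.lookup f v"]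
      arg_cong[OF assms(2), of "\<lambda>f. Poly_Mapping.lookup f v"]
    by (simp add: lookup_add)
  then show ?thesis by (simp add: poly_mapping_eqI)
qed

lemma is_min_gens_antichain:
  assumes "is_min_gens V I G" "g \<in> G" "g' \<in> G" "g = g' + d"
  shows "g = g'"
proof (rule ccontr)
  assume ne: "g \<noteq> g'"
  have G: "G \<subseteq> exps V" "G - {g} \<subseteq> exps V"
    and I: "genideal (mpoly_ring V) (monomial ` G) = I"
    using assms(1) by (auto simp: is_min_gens_def)
  have "\<exists>h \<in> G - {g}. \<exists>e. x = h + e" if "x \<in> G" for x
    using assms(3,4) that ne by (cases "x = g") (auto intro: bexI[of _ x] exI[of _ 0])
  then have "genideal (mpoly_ring V) (monomial ` G)
               \<subseteq> genideal (mpoly_ring V) (monomial ` (G - {g}))"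
    using genideal_monomial_subset_iff[OF G] by blast
  moreover have "genideal (mpoly_ring V) (monomial ` (G - {g}))
               \<subseteq> genideal (mpoly_ring V) (monomial ` G)"
    unfolding genideal_monomial_subset_iff[OF G(2,1)] by (metis DiffD1 add.right_neutral)
  ultimately have "genideal (mpoly_ring V) (monomial ` (G - {g})) = I"
    using I by blast
  moreover have "G - {g} \<subset> G" using assms(2) by blast
  ultimately show False using assms(1) by (auto simp: is_min_gens_def)
qed

lemma is_min_gens_subset:
  assumes "is_min_gens V I G" "is_min_gens V I H"
  shows "G \<subseteq> H"
proof
  fix g assume g: "g \<in> G"
  have *: "G \<subseteq> exps V" "H \<subseteq> exps V"
    "genideal (mpoly_ring V) (monomial ` G) = I" "genideal (mpoly_ring V) (monomial ` H) = I"
    using assms by (auto simp: is_min_gens_def)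
  obtain h d where h: "h \<in> H" "g = h + d"
    using genideal_monomial_subset_iff[OF *(1,2)] *(3,4) g by blast
  obtain g' e where g': "g' \<in> G" "h = g' + e"
    using genideal_monomial_subset_iff[OF *(2,1)] *(3,4) h(1) by blast
  have "g = g'"
    using is_min_gens_antichain[OF assms(1) g g'(1)] h(2) g'(2) by (simp add: add.assoc)
  with h g' exp_dvd_antisym have "g = h" by blast
  with h(1) show "g \<in> H" by simp
qed

lemma exists_minimal_exp:
  fixes a :: "'v \<Rightarrow>\<^sub>0 nat"
  assumes "a \<in> A"
  shows "\<exists>g \<in> A. (\<exists>d. a = g + d) \<and> (\<forall>b \<in> A. (\<exists>d. g = b + d) \<longrightarrow> b = g)"
  using assms
proof (induction "\<Sum>v \<in> Poly_Mapping.keys a. Poly_Mapping.lookup a v"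
    arbitrary: a rule: less_induct)
  case less
  show ?case
  proof (cases "\<forall>b \<in> A. (\<exists>d. a = b + d) \<longrightarrow> b = a")
    case True
    with less.prems show ?thesis by (auto intro!: bexI[of _ a] exI[of _ 0])
  next
    case False
    then obtain b d where b: "b \<in> A" "a = b + d" "b \<noteq> a" by blast
    then have "d \<noteq> 0" by auto
    then obtain v where v: "v \<in> Poly_Mapping.keys d" by (metis ex_in_conv keys_eq_empty)
    have "(\<Sum>v \<in> Poly_Mapping.keys b. Poly_Mapping.lookup b v)
            = (\<Sum>v \<in> Poly_Mapping.keys a. Poly_Mapping.lookup b v)"
      by (rule sum.mono_neutral_left) (auto simp: b(2) keys_add_nat in_keys_iff)
    also have "\<dots> < (\<Sum>v \<in> Poly_Mapping.keys a. Poly_Mapping.lookup a v)"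
      using v by (intro sum_strict_mono_ex1)
        (auto simp: b(2) lookup_add keys_add_nat in_keys_iff intro!: bexI[of _ v])
    finally obtain g e where "g \<in> A" "b = g + e" "\<forall>b \<in> A. (\<exists>d. g = b + d) \<longrightarrow> b = g"
      using less.hyps[of b] b(1) by blast
    then show ?thesis using b(2) by (auto simp: add.assoc intro!: bexI[of _ g])
  qed
qed

lemma ex1_min_gens:
  assumes "monomial_ideal V I"
  shows "\<exists>!G. is_min_gens V I G"
proof (rule ex_ex1I)
  obtain A where A: "A \<subseteq> exps V" and I: "I = genideal (mpoly_ring V) (monomial ` A)"
    using assms by (auto simp: monomial_ideal_def)
  define G where "G = {g \<in> A. \<forall>b \<in> A. (\<exists>d. g = b + d) \<longrightarrow> b = g}"
  have G: "G \<subseteq> A" "G \<subseteq> exps V" using A by (auto simp: G_def)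
  have "I \<subseteq> genideal (mpoly_ring V) (monomial ` G)"
    unfolding I genideal_monomial_subset_iff[OF A G(2)]
    using exists_minimal_exp[of _ A] unfolding G_def by blast
  moreover have "genideal (mpoly_ring V) (monomial ` G) \<subseteq> I"
    unfolding I genideal_monomial_subset_iff[OF G(2) A]
    using G(1) by (metis add.right_neutral subsetD)
  moreover have "genideal (mpoly_ring V) (monomial ` G') \<noteq> I" if G': "G' \<subset> G" for G'
  proof
    assume eq: "genideal (mpoly_ring V) (monomial ` G') = I"
    from G' obtain g where g: "g \<in> G" "g \<notin> G'" by blast
    have "G' \<subseteq> exps V" using G' G(2) by blast
    from genideal_monomial_subset_iff[OF A this] eq I
    obtain h d where h: "h \<in> G'" "g = h + d" using g(1) G(1) by blast
    with G' G(1) have "h \<in> A" by blast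
    with g(1) h(2) have "h = g" unfolding G_def by blast
    with g(2) h(1) show False by simp
  qed
  ultimately have "is_min_gens V I G"
    using G(2) by (auto simp: is_min_gens_def)
  then show "\<exists>G. is_min_gens V I G" ..
qed (blast dest: is_min_gens_subset)

end

theory Submission
  imports Defs "HOL-Library.Set_Algebras"
begin

text \<open>
  A monomial ideal consists of the polynomials supported on a set of exponent vectors that is
  closed under adding further exponents. In this description products of ideals become sumsets,
  and since the coefficient ring is nontrivial, the set of exponents is determined by the ideal.
  So being a demotion is a statement about sumsets and intersections of such sets of exponents
  (\<open>demotion_supported_on_iff\<close>).

  Expansion is the preimage of exponent sets under the additive map \<open>collapse\<close> that sends each
  variable \<open>x\<^bsub>jl\<^esub>\<close> to \<open>x\<^bsub>j\<^esub>\<close> (\<open>expansion_supported_on\<close>). Taking preimages always commutes with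
  intersections; it commutes with sumsets because every decomposition of \<open>collapse b\<close> as a sum
  lifts to a decomposition of \<open>b\<close> (\<open>collapse_lift_add\<close>). As every group of variables is
  nonempty, \<open>collapse\<close> is onto, so taking preimages is injective. Hence the
  two demotion conditions are equivalent.
\<close>

section \<open>Monomial ideals as sets of exponents\<close>

definition supported_on :: "('v \<Rightarrow>\<^sub>0 nat) set \<Rightarrow> (('v \<Rightarrow>\<^sub>0 nat) \<Rightarrow>\<^sub>0 'k::field) set" where
  "supported_on U = {p. Poly_Mapping.keys p \<subseteq> U}"

definition upset :: "'v set \<Rightarrow> ('v \<Rightarrow>\<^sub>0 nat) set \<Rightarrow> bool" where
  "upset V U \<longleftrightarrow> U \<subseteq> exps V \<and> U + exps V \<subseteq> U"

lemma poly_mapping_eq_sum_single: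
  "p = (\<Sum>m \<in> Poly_Mapping.keys p. Poly_Mapping.single m (Poly_Mapping.lookup p m))"
proof (rule poly_mapping_eqI)
  fix k
  have "Poly_Mapping.lookup (\<Sum>m \<in> Poly_Mapping.keys p.
      Poly_Mapping.single m (Poly_Mapping.lookup p m)) k
    = (\<Sum>m \<in> Poly_Mapping.keys p. if m = k then Poly_Mapping.lookup p m else 0)"
    by (simp add: lookup_sum lookup_single when_def)
  then show "Poly_Mapping.lookup p k = Poly_Mapping.lookup (\<Sum>m \<in> Poly_Mapping.keys p.
      Poly_Mapping.single m (Poly_Mapping.lookup p m)) k"
    by (simp add: in_keys_iff)
qed

text \<open>
  For lower bounds on generated ideals and on products of ideals: a polynomial is the sum of its
  terms, so it suffices to find each single term in the ideal.
\<close>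

lemma supported_on_subsetI:
  assumes zero: "0 \<in> S" and add: "\<And>p q. p \<in> S \<Longrightarrow> q \<in> S \<Longrightarrow> p + q \<in> S"
    and single: "\<And>m c. m \<in> U \<Longrightarrow> Poly_Mapping.single m c \<in> S"
  shows "supported_on U \<subseteq> S"
proof
  fix p :: "('a \<Rightarrow>\<^sub>0 nat) \<Rightarrow>\<^sub>0 'b" assume p: "p \<in> supported_on U"
  have "(\<Sum>m \<in> M. Poly_Mapping.single m (Poly_Mapping.lookup p m)) \<in> S"
    if "finite M" "M \<subseteq> U" for M
    using that by (induction M rule: finite_induct) (auto intro: zero add single)
  from this[of "Poly_Mapping.keys p"] show "p \<in> S"
    using p by (simp add: supported_on_def flip: poly_mapping_eq_sum_single)
qed

lemma supported_on_add:
  "p \<in> supported_on U \<Longrightarrow> q \<in> supported_on U \<Longrightarrow> p + q \<in> supported_on U"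
  using keys_add[of p q] by (auto simp: supported_on_def)

lemma single_in_supported_on: "m \<in> U \<Longrightarrow> Poly_Mapping.single m c \<in> supported_on U"
  by (simp add: supported_on_def)

lemma supported_on_mult:
  "p \<in> supported_on U \<Longrightarrow> q \<in> supported_on W \<Longrightarrow> p * q \<in> supported_on (U + W)"
  using keys_mult[of p q] by (fastforce simp: supported_on_def set_plus_def)

lemma supported_on_subset_iff:
  "(supported_on U :: (_ \<Rightarrow>\<^sub>0 'k::field) set) \<subseteq> supported_on W \<longleftrightarrow> U \<subseteq> W"
proof
  assume "(supported_on U :: (_ \<Rightarrow>\<^sub>0 'k) set) \<subseteq> supported_on W"
  moreover have "u \<in> W \<longleftrightarrow> (monomial u :: _ \<Rightarrow>\<^sub>0 'k) \<in> supported_on W" for u W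
    by (simp add: supported_on_def monomial_def)
  ultimately show "U \<subseteq> W" by blast
qed (auto simp: supported_on_def)

lemma supported_on_inject:
  "(supported_on U :: (_ \<Rightarrow>\<^sub>0 'k::field) set) = supported_on W \<longleftrightarrow> U = W"
  by (simp add: set_eq_subset supported_on_subset_iff)

lemma supported_on_Int: "supported_on U \<inter> supported_on W = supported_on (U \<inter> W)"
  by (auto simp: supported_on_def)

lemma carrier_mpoly_ring: "carrier (mpoly_ring V) = supported_on (exps V)"
  by (simp add: mpoly_ring_def supported_on_def)

lemma zero_in_exps: "0 \<in> exps V"
  by (simp add: exps_def)

lemma exps_plus_exps: "exps V + exps V = exps V"
  using set_zero_plus2[OF zero_in_exps] by (fastforce simp: set_plus_def exps_add_iff)

lemma plus_exps_assoc: "(A + exps V) + (B + exps V) = (A + B) + exps V"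
  using exps_plus_exps[of V] by (metis add.assoc add.left_commute)

lemma upset_exps: "upset V (exps V)"
  by (simp add: upset_def exps_plus_exps)

lemma upset_plus_exps: "A \<subseteq> exps V \<Longrightarrow> upset V (A + exps V)"
  unfolding upset_def using exps_plus_exps[of V] set_plus_mono2[of A "exps V" "exps V" "exps V"]
  by (simp add: add.assoc)

lemma upset_plus: "upset V U \<Longrightarrow> upset V W \<Longrightarrow> upset V (U + W)"
  unfolding upset_def using exps_plus_exps[of V] set_plus_mono2[of U "exps V" W "exps V"]
    set_plus_mono2[of U U "W + exps V" W]
  by (simp add: add.assoc)

lemma ideal_supported_on:
  assumes "upset V U"
  shows "ideal (supported_on U) (mpoly_ring V :: (('v \<Rightarrow>\<^sub>0 nat) \<Rightarrow>\<^sub>0 'k::field) ring)"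
proof (rule idealI)
  let ?R = "mpoly_ring V :: (('v \<Rightarrow>\<^sub>0 nat) \<Rightarrow>\<^sub>0 'k) ring"
  interpret R: cring ?R by (rule cring_mpoly_ring)
  have U: "U \<subseteq> exps V" "U + exps V \<subseteq> U" using assms by (auto simp: upset_def)
  then have sub: "supported_on U \<subseteq> carrier ?R"
    by (simp add: carrier_mpoly_ring supported_on_subset_iff)
  show "ring ?R" by (rule R.ring_axioms)
  show "subgroup (supported_on U) (add_monoid ?R)"
  proof (rule group.subgroupI)
    show "group (add_monoid ?R)" by (rule R.a_group)
    show "supported_on U \<subseteq> carrier (add_monoid ?R)" using sub by simp
    show "supported_on U \<noteq> {}" by (auto simp: supported_on_def intro!: exI[of _ 0])
  next
    fix p :: "_ \<Rightarrow>\<^sub>0 'k" assume p: "p \<in> supported_on U"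
    then have "- p \<in> supported_on U" by (simp add: supported_on_def)
    moreover have "\<ominus>\<^bsub>?R\<^esub> p = - p"
      using p calculation sub by (intro R.minus_equality) (auto simp: mpoly_ring_def)
    ultimately show "inv\<^bsub>add_monoid ?R\<^esub> p \<in> supported_on U"
      by (simp add: a_inv_def)
  next
    fix p q :: "_ \<Rightarrow>\<^sub>0 'k" assume "p \<in> supported_on U" "q \<in> supported_on U"
    then show "p \<otimes>\<^bsub>add_monoid ?R\<^esub> q \<in> supported_on U"
      by (simp add: supported_on_add mpoly_ring_def)
  qed
  have mult: "p * q \<in> supported_on U"
    if "p \<in> supported_on U" "q \<in> carrier ?R" for p q
    using supported_on_mult[of p U q "exps V"] that U(2)
      supported_on_subset_iff[of "U + exps V" U, where 'k = 'k]
    by (auto simp: carrier_mpoly_ring)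
  show "x \<otimes>\<^bsub>?R\<^esub> p \<in> supported_on U" if "p \<in> supported_on U" "x \<in> carrier ?R" for p x
    using mult[OF that] by (simp add: mpoly_ring_def mult.commute)
  show "p \<otimes>\<^bsub>?R\<^esub> x \<in> supported_on U" if "p \<in> supported_on U" "x \<in> carrier ?R" for p x
    using mult[OF that] by (simp add: mpoly_ring_def)
qed

lemma genideal_UN_supported_on:
  fixes V :: "'v set" and F :: "'b \<Rightarrow> ('v \<Rightarrow>\<^sub>0 nat) set"
  assumes "\<And>a. a \<in> A \<Longrightarrow> upset V (F a)"
  shows "genideal (mpoly_ring V) (\<Union>a \<in> A. supported_on (F a))
           = (supported_on (\<Union>a \<in> A. F a) :: (_ \<Rightarrow>\<^sub>0 'k::field) set)"
proof
  let ?R = "mpoly_ring V :: (('v \<Rightarrow>\<^sub>0 nat) \<Rightarrow>\<^sub>0 'k) ring"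
  interpret R: cring ?R by (rule cring_mpoly_ring)
  have "upset V (\<Union>a \<in> A. F a)"
    using assms by (fastforce simp: upset_def set_plus_def)
  then have "ideal (supported_on (\<Union>a \<in> A. F a)) ?R"
    by (rule ideal_supported_on)
  then show "genideal ?R (\<Union>a \<in> A. supported_on (F a)) \<subseteq> supported_on (\<Union>a \<in> A. F a)"
    by (rule R.genideal_minimal) (auto simp: supported_on_def)
  have gens: "(\<Union>a \<in> A. supported_on (F a)) \<subseteq> carrier ?R"
    using assms by (simp add: UN_least carrier_mpoly_ring supported_on_subset_iff upset_def)
  interpret I: ideal "genideal ?R (\<Union>a \<in> A. supported_on (F a))" ?R
    by (rule R.genideal_ideal[OF gens])
  show "supported_on (\<Union>a \<in> A. F a) \<subseteq> genideal ?R (\<Union>a \<in> A. supported_on (F a))"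
  proof (rule supported_on_subsetI)
    show "0 \<in> genideal ?R (\<Union>a \<in> A. supported_on (F a))"
      using I.zero_closed by (simp add: mpoly_ring_def)
    show "p + q \<in> genideal ?R (\<Union>a \<in> A. supported_on (F a))"
      if "p \<in> genideal ?R (\<Union>a \<in> A. supported_on (F a))"
        "q \<in> genideal ?R (\<Union>a \<in> A. supported_on (F a))" for p q
      using I.a_closed[OF that] by (simp add: mpoly_ring_def)
    show "Poly_Mapping.single m c \<in> genideal ?R (\<Union>a \<in> A. supported_on (F a))"
      if "m \<in> (\<Union>a \<in> A. F a)" for m c
      using that R.genideal_self[OF gens] single_in_supported_on by blast
  qed
qed

lemma genideal_monomials:
  fixes V :: "'v set"
  assumes "A \<subseteq> exps V"
  shows "genideal (mpoly_ring V) (monomial ` A)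
           = (supported_on (A + exps V) :: (_ \<Rightarrow>\<^sub>0 'k::field) set)"
proof
  let ?R = "mpoly_ring V :: (('v \<Rightarrow>\<^sub>0 nat) \<Rightarrow>\<^sub>0 'k) ring"
  interpret R: cring ?R by (rule cring_mpoly_ring)
  have gens: "monomial ` A \<subseteq> carrier ?R"
    using assms by (auto intro: monomial_closed)
  show "genideal ?R (monomial ` A) \<subseteq> supported_on (A + exps V)"
  proof (rule R.genideal_minimal)
    show "ideal (supported_on (A + exps V)) ?R"
      by (intro ideal_supported_on upset_plus_exps assms)
    have "a \<in> A + exps V" if "a \<in> A" for a
      using set_plus_intro[OF that zero_in_exps[of V]] by simp
    then show "monomial ` A \<subseteq> supported_on (A + exps V)"
      by (auto simp: monomial_def intro: single_in_supported_on)
  qed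
  interpret I: ideal "genideal ?R (monomial ` A)" ?R
    by (rule R.genideal_ideal[OF gens])
  show "supported_on (A + exps V) \<subseteq> genideal ?R (monomial ` A)"
  proof (rule supported_on_subsetI)
    show "0 \<in> genideal ?R (monomial ` A)"
      using I.zero_closed by (simp add: mpoly_ring_def)
    show "p + q \<in> genideal ?R (monomial ` A)"
      if "p \<in> genideal ?R (monomial ` A)" "q \<in> genideal ?R (monomial ` A)" for p q
      using I.a_closed[OF that] by (simp add: mpoly_ring_def)
    show "Poly_Mapping.single m c \<in> genideal ?R (monomial ` A)" if m: "m \<in> A + exps V" for m c
    proof -
      obtain a h where ah: "a \<in> A" "h \<in> exps V" "m = a + h"
        using m by (auto simp: set_plus_def)
      have "monomial a \<otimes>\<^bsub>?R\<^esub> Poly_Mapping.single h c \<in> genideal ?R (monomial ` A)"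
        using ah R.genideal_self[OF gens]
        by (intro I.I_r_closed) (auto simp: carrier_mpoly_ring single_in_supported_on)
      then show ?thesis
        by (simp add: ah(3) monomial_def mpoly_ring_def mult_single)
    qed
  qed
qed

lemma monomial_idealE:
  assumes "monomial_ideal V I"
  obtains U where "upset V U" "I = supported_on U"
  using assms unfolding monomial_ideal_def by (metis genideal_monomials upset_plus_exps)

lemma min_gens_plus_exps:
  assumes "upset V U"
  shows "min_gens V (supported_on U :: (_ \<Rightarrow>\<^sub>0 'k::field) set) \<subseteq> exps V"
    and "min_gens V (supported_on U :: (_ \<Rightarrow>\<^sub>0 'k::field) set) + exps V = U"
proof -
  let ?I = "supported_on U :: (_ \<Rightarrow>\<^sub>0 'k) set"
  have U: "U \<subseteq> exps V" using assms by (simp add: upset_def)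
  have "U \<subseteq> U + exps V"
    using set_zero_plus2[OF zero_in_exps, of U V] by (simp only: add.commute)
  then have "U + exps V = U"
    using assms unfolding upset_def by (intro antisym) blast+
  then have "?I = genideal (mpoly_ring V) (monomial ` U)"
    by (simp only: genideal_monomials[OF U])
  then have "monomial_ideal V ?I"
    using U unfolding monomial_ideal_def by blast
  then have "is_min_gens V ?I (min_gens V ?I)"
    unfolding min_gens_def by (rule theI'[OF ex1_min_gens])
  then have G: "min_gens V ?I \<subseteq> exps V"
    "genideal (mpoly_ring V) (monomial ` min_gens V ?I) = ?I"
    unfolding is_min_gens_def by blast+
  show "min_gens V ?I \<subseteq> exps V" by (rule G(1))
  show "min_gens V ?I + exps V = U"
    using G(2) unfolding genideal_monomials[OF G(1)] by (simp only: supported_on_inject)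
qed

text \<open>
  A term with exponent \<open>u + w\<close> is a product of two terms, and conversely the exponents of a product
  of polynomials are sums of exponents of the factors.
\<close>

lemma ideal_prod_supported_on:
  "ideal_prod (mpoly_ring V) (supported_on U) (supported_on W)
     = (supported_on (U + W) :: (_ \<Rightarrow>\<^sub>0 'k::field) set)"
  (is "?P = _")
proof
  show "?P \<subseteq> supported_on (U + W)"
  proof
    fix p assume "p \<in> ?P"
    then show "p \<in> supported_on (U + W)"
      by induction (auto simp: mpoly_ring_def intro: supported_on_mult supported_on_add)
  qed
  have prod: "p * q \<in> ?P" if "p \<in> supported_on U" "q \<in> supported_on W" for p q
    using ideal_prod.prod[OF that, of "mpoly_ring V"] by (simp add: mpoly_ring_def)
  show "supported_on (U + W) \<subseteq> ?P"
  proof (rule supported_on_subsetI)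
    show "0 \<in> ?P" using prod[of 0 0] by (simp add: supported_on_def)
    show "p + q \<in> ?P" if "p \<in> ?P" "q \<in> ?P" for p q
      using ideal_prod.sum[OF that] by (simp add: mpoly_ring_def)
    show "Poly_Mapping.single m c \<in> ?P" if m: "m \<in> U + W" for m c
    proof -
      obtain u w where uw: "u \<in> U" "w \<in> W" "m = u + w"
        using m by (auto simp: set_plus_def)
      have "Poly_Mapping.single u 1 * Poly_Mapping.single w c \<in> ?P"
        using uw by (intro prod single_in_supported_on)
      then show ?thesis by (simp add: uw(3) mult_single)
    qed
  qed
qed

text \<open>
  The zeroth power is the exponent set of the whole ring, in accordance with the convention that
  the zeroth power of an ideal is the unit ideal.
\<close>

primrec exps_power :: "'v set \<Rightarrow> ('v \<Rightarrow>\<^sub>0 nat) set \<Rightarrow> nat \<Rightarrow> ('v \<Rightarrow>\<^sub>0 nat) set" where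
  "exps_power V U 0 = exps V"
| "exps_power V U (Suc r) = exps_power V U r + U"

lemma upset_exps_power: "upset V U \<Longrightarrow> upset V (exps_power V U r)"
  by (induction r) (auto intro: upset_exps upset_plus)

lemma ideal_power_supported_on:
  "(supported_on U :: (_ \<Rightarrow>\<^sub>0 'k::field) set) [^]\<^bsub>ideals_set (mpoly_ring V)\<^esub> r
     = supported_on (exps_power V U r)"
  by (induction r)
    (simp_all add: nat_pow_def ideals_set_def carrier_mpoly_ring ideal_prod_supported_on)

lemma demotion_supported_on_iff:
  assumes "upset V U" "upset V W"
  shows "demotion (mpoly_ring V) (supported_on W) (supported_on U :: (_ \<Rightarrow>\<^sub>0 'k::field) set)
    \<longleftrightarrow> W \<subseteq> U \<and> (\<forall>r s. exps_power V U r + exps_power V W s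
                        = exps_power V U (r + s) \<inter> exps_power V W s)"
  by (simp add: demotion_def ideal_supported_on assms ideal_power_supported_on
      ideal_prod_supported_on supported_on_Int supported_on_inject supported_on_subset_iff)


section \<open>Collapsing groups of variables\<close>

text \<open>
  The action on exponents of the substitution of the variable \<open>\<pi> x\<close> for each variable \<open>x\<close> in \<open>W\<close>.
\<close>

definition collapse :: "('w \<Rightarrow> 'v) \<Rightarrow> 'w set \<Rightarrow> ('w \<Rightarrow>\<^sub>0 nat) \<Rightarrow> ('v \<Rightarrow>\<^sub>0 nat)" where
  "collapse \<pi> W b = (\<Sum>x \<in> W. Poly_Mapping.single (\<pi> x) (Poly_Mapping.lookup b x))"

definition collapse_preimage ::
    "('w \<Rightarrow> 'v) \<Rightarrow> 'w set \<Rightarrow> ('v \<Rightarrow>\<^sub>0 nat) set \<Rightarrow> ('w \<Rightarrow>\<^sub>0 nat) set" where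
  "collapse_preimage \<pi> W U = {b \<in> exps W. collapse \<pi> W b \<in> U}"

lemma exponent_induct [case_names zero add_single]:
  fixes a :: "'v \<Rightarrow>\<^sub>0 nat"
  assumes zero: "P 0" and add: "\<And>a v. P a \<Longrightarrow> P (a + Poly_Mapping.single v 1)"
  shows "P a"
proof -
  have step: "P (b + Poly_Mapping.single v k)" if "P b" for b v and k :: nat
  proof (induction k)
    case (Suc k)
    have "Poly_Mapping.single v (Suc k) = Poly_Mapping.single v k + Poly_Mapping.single v 1"
      by (simp flip: single_add)
    with add[OF Suc, of v] show ?case by (simp add: add.assoc)
  qed (simp add: that)
  have "P (\<Sum>v \<in> M. Poly_Mapping.single v (Poly_Mapping.lookup a v))" if "finite M" for M
    using that by (induction M rule: finite_induct) (auto simp: zero dest: step simp: add.commute)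
  from this[of "Poly_Mapping.keys a"] show ?thesis
    by (simp flip: poly_mapping_eq_sum_single)
qed

lemma exponent_split_single:
  fixes a :: "'v \<Rightarrow>\<^sub>0 nat"
  assumes "Poly_Mapping.lookup a v > 0"
  obtains a' where "a = a' + Poly_Mapping.single v 1"
proof
  show "a = (a - Poly_Mapping.single v 1) + Poly_Mapping.single v 1"
    using assms by (intro poly_mapping_eqI) (auto simp: lookup_add lookup_minus lookup_single when_def)
qed

lemma collapse_zero: "collapse \<pi> W 0 = 0"
  by (simp add: collapse_def)

lemma collapse_add: "collapse \<pi> W (b + c) = collapse \<pi> W b + collapse \<pi> W c"
  by (simp add: collapse_def lookup_add single_add sum.distrib)

lemma single_in_exps_iff: "Poly_Mapping.single v (1 :: nat) \<in> exps V \<longleftrightarrow> v \<in> V"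
  by (simp add: exps_def)

locale variable_surjection =
  fixes \<pi> :: "'w \<Rightarrow> 'v" and W :: "'w set" and V :: "'v set"
  assumes finite: "finite W" and surj: "\<pi> ` W = V"
begin

abbreviation "col \<equiv> collapse \<pi> W"
abbreviation "pre \<equiv> collapse_preimage \<pi> W"

lemma collapse_single:
  assumes "x \<in> W"
  shows "col (Poly_Mapping.single x k) = Poly_Mapping.single (\<pi> x) k"
proof -
  have "col (Poly_Mapping.single x k)
          = (\<Sum>y \<in> W. if x = y then Poly_Mapping.single (\<pi> x) k else 0)"
    unfolding collapse_def by (rule sum.cong) (auto simp: lookup_single when_def)
  then show ?thesis using assms finite by simp
qed

lemma collapse_in_exps: "b \<in> exps W \<Longrightarrow> col b \<in> exps V"
proof (induction b rule: exponent_induct)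
  case (add_single b x)
  then show ?case
    using surj by (auto simp: exps_add_iff single_in_exps_iff collapse_add collapse_single
        simp del: One_nat_def)
qed (simp add: collapse_zero zero_in_exps)

lemma collapse_surj: "a \<in> exps V \<Longrightarrow> \<exists>b \<in> exps W. col b = a"
proof (induction a rule: exponent_induct)
  case zero
  show ?case using collapse_zero zero_in_exps by blast
next
  case (add_single a v)
  then obtain b where b: "b \<in> exps W" "col b = a" and "v \<in> V"
    by (auto simp: exps_add_iff single_in_exps_iff simp del: One_nat_def)
  then obtain x where x: "x \<in> W" "v = \<pi> x" using surj by blast
  show ?case
    by (rule bexI[of _ "b + Poly_Mapping.single x 1"])
      (use b x in \<open>simp_all add: exps_add_iff single_in_exps_iff collapse_add collapse_single
        del: One_nat_def\<close>)
qed

text \<open>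
  The multiset of variables counted by \<open>b\<close> is mapped onto the multiset counted by \<open>u + w\<close>, so its
  elements can be distributed one at a time: a variable of \<open>b\<close> goes to whichever of the two
  summands still has its image.
\<close>

lemma collapse_lift_add:
  "b \<in> exps W \<Longrightarrow> col b = u + w \<Longrightarrow>
     \<exists>c \<in> exps W. \<exists>d \<in> exps W. b = c + d \<and> col c = u \<and> col d = w"
proof (induction b arbitrary: u w rule: exponent_induct)
  case zero
  then have "Poly_Mapping.lookup u v = 0 \<and> Poly_Mapping.lookup w v = 0" for v
    using lookup_add[of u w v] by (simp add: collapse_zero flip: zero.prems(2))
  then have "u = 0" "w = 0" by (auto intro: poly_mapping_eqI)
  then show ?case using zero_in_exps collapse_zero by (metis add.right_neutral)
next
  case (add_single b x)
  let ?x = "Poly_Mapping.single x (1 :: nat)" and ?j = "Poly_Mapping.single (\<pi> x) (1 :: nat)"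
  have b: "b \<in> exps W" and x: "x \<in> W" "?x \<in> exps W"
    using add_single.prems(1) by (simp_all add: exps_add_iff single_in_exps_iff del: One_nat_def)
  have eq: "col b + ?j = u + w"
    using add_single.prems(2) x(1) by (simp add: collapse_add collapse_single del: One_nat_def)
  from arg_cong[OF this, of "\<lambda>a. Poly_Mapping.lookup a (\<pi> x)"]
  have "Poly_Mapping.lookup u (\<pi> x) > 0 \<or> Poly_Mapping.lookup w (\<pi> x) > 0"
    by (auto simp: lookup_add)
  then show ?case
  proof
    assume "Poly_Mapping.lookup u (\<pi> x) > 0"
    then obtain u' where u': "u = u' + ?j" by (rule exponent_split_single)
    have "col b + ?j = (u' + w) + ?j" using eq u' by (simp add: ac_simps)
    then have "col b = u' + w" by (simp only: add_right_cancel)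
    with add_single.IH b obtain c d where
      "c \<in> exps W" "d \<in> exps W" "b = c + d" "col c = u'" "col d = w" by blast
    then show ?thesis
      using x u' by (intro bexI[of _ "c + ?x"] bexI[of _ d])
        (simp_all add: exps_add_iff collapse_add collapse_single ac_simps del: One_nat_def)
  next
    assume "Poly_Mapping.lookup w (\<pi> x) > 0"
    then obtain w' where w': "w = w' + ?j" by (rule exponent_split_single)
    have "col b + ?j = (u + w') + ?j" using eq w' by (simp add: ac_simps)
    then have "col b = u + w'" by (simp only: add_right_cancel)
    with add_single.IH b obtain c d where
      "c \<in> exps W" "d \<in> exps W" "b = c + d" "col c = u" "col d = w'" by blast
    then show ?thesis
      using x w' by (intro bexI[of _ c] bexI[of _ "d + ?x"])
        (simp_all add: exps_add_iff collapse_add collapse_single ac_simps del: One_nat_def)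
  qed
qed

lemma preimage_plus: "pre (A + B) = pre A + pre B"
proof
  show "pre (A + B) \<subseteq> pre A + pre B"
    using collapse_lift_add unfolding collapse_preimage_def set_plus_def by fastforce
  show "pre A + pre B \<subseteq> pre (A + B)"
    by (auto simp: collapse_preimage_def exps_add_iff collapse_add elim!: set_plus_elim)
qed

lemma preimage_exps: "pre (exps V) = exps W"
  by (auto simp: collapse_preimage_def collapse_in_exps)

lemma preimage_Int: "pre (A \<inter> B) = pre A \<inter> pre B"
  by (auto simp: collapse_preimage_def)

lemma preimage_UN: "pre (\<Union>a \<in> A. F a) = (\<Union>a \<in> A. pre (F a))"
  by (auto simp: collapse_preimage_def)

lemma preimage_subset_iff: "A \<subseteq> exps V \<Longrightarrow> pre A \<subseteq> pre B \<longleftrightarrow> A \<subseteq> B"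
  using collapse_surj by (fastforce simp: collapse_preimage_def)

lemma preimage_inject: "A \<subseteq> exps V \<Longrightarrow> B \<subseteq> exps V \<Longrightarrow> pre A = pre B \<longleftrightarrow> A = B"
  by (simp add: set_eq_subset preimage_subset_iff)

lemma preimage_power: "pre (exps_power V U r) = exps_power W (pre U) r"
  by (induction r) (simp_all add: preimage_exps preimage_plus)

lemma upset_preimage: "upset V U \<Longrightarrow> upset W (pre U)"
  unfolding upset_def preimage_exps[symmetric] preimage_plus[symmetric]
  by (auto simp: collapse_preimage_def)

text \<open>
  The exponents of a prime \<open>\<pp>\<^sub>j\<close> of the expansion are a preimage too, so that powers and products
  of these primes can be computed before taking preimages. If \<open>x\<^sub>j\<close> divides the image of a
  monomial, then lifting the factorization splits off a monomial with image \<open>x\<^sub>j\<close>, which is a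
  single variable.
\<close>

lemma preimage_variable:
  "pre ({Poly_Mapping.single j 1} + exps V)
     = (\<lambda>x. Poly_Mapping.single x 1) ` {x \<in> W. \<pi> x = j} + exps W"
proof
  let ?j = "Poly_Mapping.single j (1 :: nat)"
  show "pre ({?j} + exps V)
      \<subseteq> (\<lambda>x. Poly_Mapping.single x 1) ` {x \<in> W. \<pi> x = j} + exps W"
  proof
    fix b assume "b \<in> pre ({?j} + exps V)"
    then obtain c d where cd: "c \<in> exps W" "d \<in> exps W" "b = c + d" "col c = ?j"
      unfolding preimage_plus by (auto simp: collapse_preimage_def set_plus_def)
    (* any variable of c will do: as c has total degree one, it is the only one *)
    then have "c \<noteq> 0"
      by (metis collapse_zero lookup_single_eq lookup_zero zero_neq_one)
    then obtain x where x: "x \<in> Poly_Mapping.keys c" by (metis ex_in_conv keys_eq_empty)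
    then have "Poly_Mapping.lookup c x > 0" by (simp add: in_keys_iff)
    then obtain c' where c': "c = c' + Poly_Mapping.single x 1"
      by (rule exponent_split_single)
    have W: "x \<in> W" using x cd(1) by (auto simp: exps_def)
    then have "col c' + Poly_Mapping.single (\<pi> x) 1 = ?j"
      using cd(4) by (simp add: c' collapse_add collapse_single)
    from arg_cong[OF this, of "\<lambda>a. Poly_Mapping.lookup a (\<pi> x)"] have "\<pi> x = j"
      by (auto simp: lookup_add lookup_single when_def split: if_splits)
    moreover have "b = Poly_Mapping.single x 1 + (c' + d)" "c' + d \<in> exps W"
      using cd by (simp_all add: c' ac_simps exps_add_iff)
    ultimately show "b \<in> (\<lambda>x. Poly_Mapping.single x 1) ` {x \<in> W. \<pi> x = j} + exps W"
      using W by (simp only:) (intro set_plus_intro imageI CollectI conjI; simp)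
  qed
  show "(\<lambda>x. Poly_Mapping.single x 1) ` {x \<in> W. \<pi> x = j} + exps W \<subseteq> pre ({?j} + exps V)"
    unfolding preimage_plus preimage_exps
    by (rule set_plus_mono2)
      (auto simp: collapse_preimage_def collapse_single single_in_exps_iff simp del: One_nat_def)
qed

text \<open>
  Every ingredient of the exponent form of the condition (inclusion, sumset, power, intersection)
  is preserved and reflected by \<open>pre\<close>.
\<close>

lemma demotion_preimage_iff:
  assumes U: "upset V U" and U': "upset V U'"
  shows "demotion (mpoly_ring V) (supported_on U') (supported_on U :: (_ \<Rightarrow>\<^sub>0 'k::field) set)
    \<longleftrightarrow> demotion (mpoly_ring W) (supported_on (pre U'))
          (supported_on (pre U) :: (_ \<Rightarrow>\<^sub>0 'k) set)"
proof -
  have "exps_power W (pre U) r + exps_power W (pre U') s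
          = exps_power W (pre U) (r + s) \<inter> exps_power W (pre U') s
    \<longleftrightarrow> exps_power V U r + exps_power V U' s
          = exps_power V U (r + s) \<inter> exps_power V U' s" for r s
  proof -
    have up: "upset V (exps_power V U r)" "upset V (exps_power V U' s)"
      using assms by (auto intro: upset_exps_power)
    then have "exps_power V U r + exps_power V U' s \<subseteq> exps V"
      "exps_power V U (r + s) \<inter> exps_power V U' s \<subseteq> exps V"
      using upset_plus[OF up] by (auto simp: upset_def)
    then show ?thesis
      by (simp add: preimage_inject flip: preimage_power preimage_plus preimage_Int)
  qed
  moreover have "pre U' \<subseteq> pre U \<longleftrightarrow> U' \<subseteq> U"
    using U' by (simp add: preimage_subset_iff upset_def)
  ultimately show ?thesis
    by (simp add: demotion_supported_on_iff assms upset_preimage)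
qed

end


section \<open>Expansion is the preimage under collapsing\<close>

lemma variable_surjection_expansion:
  assumes "\<forall>j \<in> {1..n}. 0 < i j"
  shows "variable_surjection fst (expansion_vars n i) {1..n}"
proof
  show "fst ` expansion_vars n i = {1..n}"
    using assms by (force simp: expansion_vars_def image_iff)
qed (simp add: expansion_vars_def)

lemma exps_power_single:
  "exps_power V ({Poly_Mapping.single j (1 :: nat)} + exps V) k
     = {Poly_Mapping.single j k} + exps V"
proof (induction k)
  case (Suc k)
  have "{Poly_Mapping.single j (Suc k)}
          = {Poly_Mapping.single j k} + {Poly_Mapping.single j (1 :: nat)}"
    by (simp add: set_plus_def flip: single_add)
  then show ?case by (simp only: exps_power.simps Suc.IH plus_exps_assoc)
qed simp

lemma expansion_prime_supported_on:
  assumes "\<forall>j \<in> {1..n}. 0 < i j" "j \<in> {1..n}"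
  shows "expansion_prime n i j = (supported_on (collapse_preimage fst (expansion_vars n i)
           ({Poly_Mapping.single j 1} + exps {1..n})) :: (_ \<Rightarrow>\<^sub>0 'k::field) set)"
proof -
  interpret variable_surjection fst "expansion_vars n i" "{1..n}"
    by (rule variable_surjection_expansion[OF assms(1)])
  let ?X = "(\<lambda>x. Poly_Mapping.single x (1 :: nat)) ` {x \<in> expansion_vars n i. fst x = j}"
  have "{x \<in> expansion_vars n i. fst x = j} = Pair j ` {1..i j}"
    using assms(2) by (auto simp: expansion_vars_def)
  then have "(\<lambda>l. variable (j, l)) ` {1..i j} = (monomial ` ?X :: (_ \<Rightarrow>\<^sub>0 'k) set)"
    by (simp add: image_image variable_def)
  moreover have "?X \<subseteq> exps (expansion_vars n i)"
    by (auto simp: exps_def)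
  ultimately show ?thesis
    unfolding expansion_prime_def expansion_ring_def preimage_variable
    by (simp add: genideal_monomials)
qed

text \<open>
  The ideal attached to a minimal generator is the preimage of the principal exponent set above
  that generator, because taking preimages turns sumsets into sumsets.
\<close>

lemma expansion_generator_supported_on:
  assumes i: "\<forall>j \<in> {1..n}. 0 < i j" and a: "a \<in> exps {1..n}"
  shows "(\<Otimes>\<^bsub>ideals_set (expansion_ring n i)\<^esub> j \<in> {1..n}.
            (expansion_prime n i j :: (_ \<Rightarrow>\<^sub>0 'k::field) set)
              [^]\<^bsub>ideals_set (expansion_ring n i)\<^esub> Poly_Mapping.lookup a j)
          = supported_on (collapse_preimage fst (expansion_vars n i) ({a} + exps {1..n}))"
proof -
  interpret variable_surjection fst "expansion_vars n i" "{1..n}"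
    by (rule variable_surjection_expansion[OF i])
  let ?R = "expansion_ring n i :: ((nat \<times> nat \<Rightarrow>\<^sub>0 nat) \<Rightarrow>\<^sub>0 'k) ring"
  let ?S = "ideals_set ?R"
  interpret S: Group.comm_monoid ?S
    unfolding expansion_ring_def by (intro cring.ideals_set_is_comm_monoid cring_mpoly_ring)
  let ?U = "\<lambda>j. {Poly_Mapping.single j (Poly_Mapping.lookup a j)} + exps {1..n}"
  let ?f = "\<lambda>j. expansion_prime n i j [^]\<^bsub>?S\<^esub> Poly_Mapping.lookup a j"
  have f: "?f j = supported_on (pre (?U j))" if "j \<in> {1..n}" for j
    using expansion_prime_supported_on[OF i that, where 'k = 'k]
      preimage_power[of "{Poly_Mapping.single j 1} + exps {1..n}" "Poly_Mapping.lookup a j"]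
    by (simp add: expansion_ring_def ideal_power_supported_on exps_power_single[simplified])
  have f_closed: "?f j \<in> carrier ?S" if "j \<in> {1..n}" for j
  proof -
    have "{Poly_Mapping.single j (Poly_Mapping.lookup a j)} \<subseteq> exps {1..n}"
      using that by (auto simp: exps_def)
    then show ?thesis
      unfolding f[OF that]
      by (simp add: ideals_set_def expansion_ring_def ideal_supported_on upset_preimage
          upset_plus_exps)
  qed
  have "finprod ?S ?f M = supported_on (pre
          ({\<Sum>j \<in> M. Poly_Mapping.single j (Poly_Mapping.lookup a j)} + exps {1..n}))"
    if "finite M" "M \<subseteq> {1..n}" for M
    using that
  proof (induction M rule: finite_induct)
    case empty
    show ?case
      unfolding S.finprod_empty
      by (simp add: preimage_exps ideals_set_def expansion_ring_def carrier_mpoly_ring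
          del: One_nat_def flip: set_zero)
  next
    case (insert j M)
    then have "finprod ?S ?f (insert j M) = ?f j \<otimes>\<^bsub>?S\<^esub> finprod ?S ?f M"
      using f_closed by (intro S.finprod_insert) auto
    also have "\<dots> = supported_on (pre (?U j
        + ({\<Sum>j \<in> M. Poly_Mapping.single j (Poly_Mapping.lookup a j)} + exps {1..n})))"
      using insert f[of j]
      by (simp add: ideals_set_def expansion_ring_def ideal_prod_supported_on preimage_plus)
    also have "\<dots> = supported_on (pre
        ({\<Sum>j \<in> insert j M. Poly_Mapping.single j (Poly_Mapping.lookup a j)} + exps {1..n}))"
      using insert.hyps by (simp add: plus_exps_assoc) (simp add: set_plus_def)
    finally show ?case .
  qed
  from this[of "{1..n}"]
  have "finprod ?S ?f {1..n} = supported_on (pre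
      ({\<Sum>j \<in> {1..n}. Poly_Mapping.single j (Poly_Mapping.lookup a j)} + exps {1..n}))"
    by simp
  also have "(\<Sum>j \<in> {1..n}. Poly_Mapping.single j (Poly_Mapping.lookup a j)) = a"
    using a by (subst (2) poly_mapping_eq_sum_single, intro sum.mono_neutral_right)
      (auto simp: exps_def in_keys_iff)
  finally show ?thesis .
qed

text \<open>
  The exponent set of the ideal is the union of the principal ones above its minimal generators,
  and taking preimages commutes with unions.
\<close>

lemma expansion_supported_on:
  assumes i: "\<forall>j \<in> {1..n}. 0 < i j" and U: "upset {1..n} U"
  shows "expansion n i (supported_on U :: (_ \<Rightarrow>\<^sub>0 'k::field) set)
           = supported_on (collapse_preimage fst (expansion_vars n i) U)"
proof -
  interpret variable_surjection fst "expansion_vars n i" "{1..n}"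
    by (rule variable_surjection_expansion[OF i])
  let ?G = "min_gens {1..n} (supported_on U :: (_ \<Rightarrow>\<^sub>0 'k) set)"
  note G = min_gens_plus_exps[OF U, where 'k = 'k]
  have "expansion n i (supported_on U :: (_ \<Rightarrow>\<^sub>0 'k) set)
    = genideal (mpoly_ring (expansion_vars n i))
        (\<Union>a \<in> ?G. supported_on (pre ({a} + exps {1..n})))"
    unfolding expansion_def
    using expansion_generator_supported_on[OF i, where 'k = 'k] G(1)
    by (auto simp: subset_iff expansion_ring_def cong: SUP_cong)
  also have "\<dots> = supported_on (\<Union>a \<in> ?G. pre ({a} + exps {1..n}))"
    using G(1) by (intro genideal_UN_supported_on upset_preimage upset_plus_exps) auto
  also have "(\<Union>a \<in> ?G. pre ({a} + exps {1..n})) = pre U"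
  proof -
    have "(\<Union>a \<in> ?G. {a} + exps {1..n}) = ?G + exps {1..n}"
      by (auto simp: set_plus_def)
    then show ?thesis using G(2) by (simp flip: preimage_UN)
  qed
  finally show ?thesis .
qed

theorem proposition5p12:
  fixes n :: nat and i :: "nat \<Rightarrow> nat"
    and I J :: "((nat \<Rightarrow>\<^sub>0 nat) \<Rightarrow>\<^sub>0 'k::field) set"
  assumes "\<forall>j \<in> {1..n}. 0 < i j"
    and "monomial_ideal {1..n} I" and "monomial_ideal {1..n} J" and "J \<subseteq> I"
  shows "demotion (mpoly_ring {1..n}) J I
           \<longleftrightarrow> demotion (expansion_ring n i) (expansion n i J) (expansion n i I)"
proof -
  interpret variable_surjection fst "expansion_vars n i" "{1..n}"
    by (rule variable_surjection_expansion[OF assms(1)])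
  obtain U where U: "upset {1..n} U" "I = supported_on U"
    using assms(2) by (rule monomial_idealE)
  obtain U' where U': "upset {1..n} U'" "J = supported_on U'"
    using assms(3) by (rule monomial_idealE)
  show ?thesis
    unfolding U(2) U'(2) expansion_ring_def
    using demotion_preimage_iff[OF U(1) U'(1)]
    by (simp only: expansion_supported_on[OF assms(1) U(1)]
        expansion_supported_on[OF assms(1) U'(1)])
qed

end
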